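(* For every acyclic configuration $C$ there is an integer $s\ge 1$ such that $C$ is an $s$-configuration.
   Context: A configuration is a finite partial Steiner triple system, i.e. a finite $3$-uniform hypergraph $C=(V,\mathcal B)$ (triples called blocks) in which each pair of points lies in at most one block, and in which every point is in at least one block. A configuration $C=(V,\mathcal B)$ is acyclic if either $|\mathcal B|=1$, or it can be obtained from an acyclic configuration $C'$ by adding a new block that intersects the point set $V(C')$ in at most one point. $s$-pattern: a finite properly edge-colored forest (acyclic graph) that is the union of $s$ monochromatic matchings $M^1,\dots,M^s$ (the color classes, with distinct colors for distinct indices) such that for every $1\le i\le s$, every edge in $M^i$ has a vertex that is not covered by any edge of any $M^j$ with $i<j\le s$. $s$-configuration: a linear triple system (a $3$-uniform hypergraph in which any two triples intersect in at most one vertex) obtained from an $s$-pattern with matchings $M^1,\dots,M^s$ by taking new points $v_1,\dots,v_s$ (augmenting points), pairwise distinct and not vertices of the $s$-pattern, and replacing each edge $e\in M^i$ by the triple $e\cup\{v_i\}$, for $i=1,\dots,s$. (Being an $s$-configuration is understood up to isomorphism.) *)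

theory Defs
  imports Main
begin

text \<open>Triple systems are given by a point set \<open>V\<close> and a block set \<open>B\<close>, graphs by a vertex set \<open>W\<close>
  and a set \<open>E\<close> of two-element edges.\<close>

definition triple_system :: "'a set \<Rightarrow> 'a set set \<Rightarrow> bool" where
  "triple_system V B \<longleftrightarrow> finite V \<and> (\<forall>b\<in>B. b \<subseteq> V \<and> card b = 3)"

definition linear_triple_system :: "'a set \<Rightarrow> 'a set set \<Rightarrow> bool" where
  "linear_triple_system V B \<longleftrightarrow>
     triple_system V B \<and> (\<forall>b\<in>B. \<forall>b'\<in>B. b \<noteq> b' \<longrightarrow> card (b \<inter> b') \<le> 1)"

definition configuration :: "'a set \<Rightarrow> 'a set set \<Rightarrow> bool" where
  "configuration V B \<longleftrightarrow>
     triple_system V B \<and>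
     (\<forall>x\<in>V. \<forall>y\<in>V. x \<noteq> y \<longrightarrow> (\<forall>b\<in>B. \<forall>b'\<in>B. {x, y} \<subseteq> b \<and> {x, y} \<subseteq> b' \<longrightarrow> b = b')) \<and>
     (\<forall>x\<in>V. \<exists>b\<in>B. x \<in> b)"

text \<open>The rule \<open>add_block\<close> need not require that the result be a configuration: see
  \<open>acyclic_configuration_imp_configuration\<close> below.\<close>

inductive acyclic_configuration :: "'a set \<Rightarrow> 'a set set \<Rightarrow> bool" where
  single_block: "configuration V B \<Longrightarrow> card B = 1 \<Longrightarrow> acyclic_configuration V B"
| add_block: "acyclic_configuration V B \<Longrightarrow> b \<notin> B \<Longrightarrow> card b = 3 \<Longrightarrow> card (b \<inter> V) \<le> 1 \<Longrightarrow>
    acyclic_configuration (V \<union> b) (insert b B)"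

lemma acyclic_configuration_imp_configuration:
  "acyclic_configuration V B \<Longrightarrow> configuration V B"
proof (induction rule: acyclic_configuration.induct)
  case (single_block V B)
  then show ?case by simp
next
  case (add_block V B b)
  have conf: "configuration V B" by (rule add_block.IH)
  have sub: "c \<subseteq> V" "card c = 3" if "c \<in> B" for c
    using conf that unfolding configuration_def triple_system_def by auto
  have fin: "finite V" "finite b"
    using conf add_block.hyps unfolding configuration_def triple_system_def
    by (auto intro: card_ge_0_finite)
  have meet: "x = y" if "x \<in> b" "y \<in> b" "x \<in> V" "y \<in> V" for x y
    using add_block.hyps(4) that card_le_Suc0_iff_eq[of "b \<inter> V"] fin by auto
  have "c = c'" if xy: "x \<noteq> y" and c: "c \<in> insert b B" "{x, y} \<subseteq> c"
    and c': "c' \<in> insert b B" "{x, y} \<subseteq> c'" for x y c c'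
  proof (cases "c = b \<or> c' = b")
    case True
    then show ?thesis using xy c c' meet[of x y] sub(1)[of c] sub(1)[of c'] by auto
  next
    case False
    then have "c \<in> B" "c' \<in> B" "x \<in> V" "y \<in> V"
      using c c' sub(1)[of c] by auto
    then show ?thesis using conf xy c(2) c'(2) unfolding configuration_def by meson
  qed
  moreover have "\<exists>c\<in>insert b B. x \<in> c" if "x \<in> V \<union> b" for x
    using conf that unfolding configuration_def by blast
  moreover have "triple_system (V \<union> b) (insert b B)"
    using fin sub add_block.hyps(3) unfolding triple_system_def by auto
  ultimately show ?case unfolding configuration_def by meson
qed

definition simple_graph :: "'a set \<Rightarrow> 'a set set \<Rightarrow> bool" where
  "simple_graph W E \<longleftrightarrow> finite W \<and> (\<forall>e\<in>E. e \<subseteq> W \<and> card e = 2)"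

text \<open>A cycle is listed by its vertices, in order and without repetition.\<close>

definition is_cycle :: "'a set set \<Rightarrow> 'a list \<Rightarrow> bool" where
  "is_cycle E p \<longleftrightarrow> 3 \<le> length p \<and> distinct p \<and>
     (\<forall>k<length p. {p ! k, p ! (Suc k mod length p)} \<in> E)"

definition forest :: "'a set \<Rightarrow> 'a set set \<Rightarrow> bool" where
  "forest W E \<longleftrightarrow> simple_graph W E \<and> (\<nexists>p. is_cycle E p)"

definition matching :: "'a set set \<Rightarrow> bool" where
  "matching M \<longleftrightarrow> (\<forall>e\<in>M. \<forall>f\<in>M. e \<noteq> f \<longrightarrow> e \<inter> f = {})"

text \<open>The edge colouring is given by its colour classes \<open>M 1, \<dots>, M s\<close>: it is well defined because
  they are pairwise disjoint, and proper because they are matchings. Values of \<open>M\<close> outside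
  \<open>{1..s}\<close> are irrelevant. Isolated vertices and empty colour classes are not excluded here;
  they would give points lying in no block of the resulting triple system, so neither can occur
  when that system is a configuration.\<close>

definition s_pattern :: "nat \<Rightarrow> 'a set \<Rightarrow> (nat \<Rightarrow> 'a set set) \<Rightarrow> bool" where
  "s_pattern s W M \<longleftrightarrow>
     forest W (\<Union>i\<in>{1..s}. M i) \<and>
     (\<forall>i\<in>{1..s}. matching (M i)) \<and>
     (\<forall>i\<in>{1..s}. \<forall>j\<in>{1..s}. i \<noteq> j \<longrightarrow> M i \<inter> M j = {}) \<and>
     (\<forall>i\<in>{1..s}. \<forall>e\<in>M i. \<exists>x\<in>e. \<forall>j\<in>{i<..s}. \<forall>f\<in>M j. x \<notin> f)"

definition augmented_points :: "nat \<Rightarrow> 'a set \<Rightarrow> (nat \<Rightarrow> 'a) \<Rightarrow> 'a set" where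
  "augmented_points s W v = W \<union> v ` {1..s}"

definition augmented_blocks :: "nat \<Rightarrow> (nat \<Rightarrow> 'a set set) \<Rightarrow> (nat \<Rightarrow> 'a) \<Rightarrow> 'a set set" where
  "augmented_blocks s M v = (\<Union>i\<in>{1..s}. (\<lambda>e. e \<union> {v i}) ` M i)"

definition isomorphic_systems :: "'a set \<Rightarrow> 'a set set \<Rightarrow> 'b set \<Rightarrow> 'b set set \<Rightarrow> bool" where
  "isomorphic_systems V B V' B' \<longleftrightarrow> (\<exists>f. bij_betw f V V' \<and> (\<lambda>b. f ` b) ` B = B')"

text \<open>The pattern is taken over the point type of the system itself. This loses no generality:
  a pattern over any other type can be transported along the isomorphism.\<close>

definition s_configuration :: "nat \<Rightarrow> 'a set \<Rightarrow> 'a set set \<Rightarrow> bool" where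
  "s_configuration s V B \<longleftrightarrow>
     (\<exists>(W :: 'a set) M v.
        s_pattern s W M \<and> inj_on v {1..s} \<and> v ` {1..s} \<inter> W = {} \<and>
        linear_triple_system (augmented_points s W v) (augmented_blocks s M v) \<and>
        isomorphic_systems (augmented_points s W v) (augmented_blocks s M v) V B)"

end

theory Submission imports Defs begin

text \<open>An acyclic configuration is built block by block, and each new block \<open>b\<close> has at least two points
  outside the current system. The invariant is that the current system is the augmentation of a
  pattern, with equality and not just isomorphism. It survives the addition of \<open>b\<close> in one of
  two ways.

  If \<open>b\<close> contains an augmenting point \<open>v i\<close>, then the other two points of \<open>b\<close> are new, and they
  form an isolated edge that can be given the colour \<open>i\<close> (\<open>s_pattern_insert_isolated_edge\<close>).

  Otherwise \<open>b = {x, y, z}\<close> with \<open>y\<close> and \<open>z\<close> new and \<open>x\<close> either new or a vertex of the pattern. The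
  point \<open>y\<close> becomes the augmenting point of a fresh colour whose only edge is \<open>{x, z}\<close>. The order
  of the colours is what matters here: every edge must have a vertex that is missed by all later
  colours, so a colour inserted before all the others constrains only its own edge, and that edge
  has the new vertex \<open>z\<close> (\<open>s_pattern_prepend_pendant_edge\<close>). Placed last, the fresh colour
  could cover the only such vertex of an edge at \<open>x\<close>.

  In both cases the edge added to the forest has a vertex outside it, so no cycle can arise. The
  second construction applied to the empty pattern also yields the single block from which the
  induction starts.\<close>

section \<open>Extending forests and patterns by an edge with a new vertex\<close>

text \<open>A cycle through the new vertex \<open>z\<close> would leave it by two edges towards two different
  neighbours, but \<open>z\<close> has only the neighbour \<open>x\<close>.\<close>

lemma forest_insert_pendant_edge:
  assumes "forest W E" and z: "z \<notin> W" and "x \<noteq> z"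
  shows "forest (W \<union> {x, z}) (insert {x, z} E)"
proof -
  have graph: "simple_graph W E" and acyclic: "\<nexists>p. is_cycle E p"
    using assms(1) unfolding forest_def by auto
  have zE: "z \<notin> e" if "e \<in> E" for e
    using graph z that unfolding simple_graph_def by auto
  have "\<not> is_cycle (insert {x, z} E) p" for p
  proof
    assume cycle: "is_cycle (insert {x, z} E) p"
    let ?n = "length p"
    have len: "3 \<le> ?n" and dist: "distinct p"
      and edge: "\<And>k. k < ?n \<Longrightarrow> {p ! k, p ! (Suc k mod ?n)} \<in> insert {x, z} E"
      using cycle unfolding is_cycle_def by auto
    \<comment> \<open>The edges of \<open>p\<close> cannot all lie in \<open>E\<close>, so \<open>p\<close> uses the added edge and visits \<open>z\<close>.\<close>
    have "\<exists>k<?n. {p ! k, p ! (Suc k mod ?n)} \<notin> E"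
      using acyclic len dist unfolding is_cycle_def by blast
    then obtain k where k: "k < ?n" "{p ! k, p ! (Suc k mod ?n)} = {x, z}"
      using edge by blast
    then have "z = p ! k \<or> z = p ! (Suc k mod ?n)"
      by (auto simp: doubleton_eq_iff)
    then obtain m where m: "m < ?n" "p ! m = z"
      using k(1) len by (metis mod_less_divisor less_le_trans zero_less_numeral)
    \<comment> \<open>The neighbours of \<open>z\<close> on the cycle are \<open>p ! a\<close> and \<open>p ! c\<close>; \<open>a \<noteq> c\<close> uses length at least 3.\<close>
    define a where "a = (if m = 0 then ?n - 1 else m - 1)"
    define c where "c = (if Suc m = ?n then 0 else Suc m)"
    have ac: "a < ?n" "c < ?n" "a \<noteq> c" "Suc a mod ?n = m" "Suc m mod ?n = c"
      using m(1) len by (auto simp: a_def c_def)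
    have "{p ! a, z} = {x, z}" "{z, p ! c} = {x, z}"
      using edge[OF ac(1)] edge[OF m(1)] zE ac m(2) by auto
    then have "p ! a = p ! c"
      by (auto simp: doubleton_eq_iff)
    then show False
      using dist ac by (simp add: nth_eq_iff_index_eq)
  qed
  moreover have "simple_graph (W \<union> {x, z}) (insert {x, z} E)"
    using graph \<open>x \<noteq> z\<close> unfolding simple_graph_def by auto
  ultimately show ?thesis
    unfolding forest_def by blast
qed

lemma s_pattern_edge_subset:
  assumes "s_pattern s W M" "i \<in> {1..s}" "e \<in> M i"
  shows "e \<subseteq> W"
  using assms unfolding s_pattern_def forest_def simple_graph_def by blast

text \<open>Neither endpoint of the added edge lies on another edge, so the edge satisfies the covering
  condition in any position and affects it for no other edge.\<close>

lemma s_pattern_insert_isolated_edge: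
  assumes pattern: "s_pattern s W M" and i: "i \<in> {1..s}"
    and new: "y \<notin> W" "z \<notin> W" "y \<noteq> z"
  shows "s_pattern s (W \<union> {y, z}) (M(i := insert {y, z} (M i)))" (is "s_pattern s _ ?M")
proof -
  have fresh: "y \<notin> e" "z \<notin> e" if "j \<in> {1..s}" "e \<in> M j" for j e
    using s_pattern_edge_subset[OF pattern that] new by auto
  have un: "(\<Union>j\<in>{1..s}. ?M j) = insert {y, z} (\<Union>j\<in>{1..s}. M j)"
    using i by auto
  have "forest (W \<union> {y, z}) (\<Union>j\<in>{1..s}. ?M j)"
    unfolding un using pattern new
    by (intro forest_insert_pendant_edge) (auto simp: s_pattern_def)
  moreover have "matching (?M j)" if "j \<in> {1..s}" for j
    using pattern that fresh[OF that] unfolding s_pattern_def matching_def by auto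
  moreover have "?M j \<inter> ?M k = {}" if "j \<in> {1..s}" "k \<in> {1..s}" "j \<noteq> k" for j k
    using pattern that fresh[OF that(1)] fresh[OF that(2)] unfolding s_pattern_def by auto
  moreover have "\<exists>x\<in>e. \<forall>k\<in>{j<..s}. \<forall>f\<in>?M k. x \<notin> f" if j: "j \<in> {1..s}" and e: "e \<in> ?M j" for j e
  proof (cases "e \<in> M j")
    case True
    then obtain x where x: "x \<in> e" "\<forall>k\<in>{j<..s}. \<forall>f\<in>M k. x \<notin> f"
      using pattern j unfolding s_pattern_def by blast
    have "x \<notin> {y, z}"
      using fresh[OF j True] x(1) by auto
    then show ?thesis using x by auto
  next
    case False
    then have "e = {y, z}" "j = i"
      using e by (auto split: if_splits)
    moreover have "y \<notin> f" if "k \<in> {i<..s}" "f \<in> ?M k" for k f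
      using fresh(1)[of k f] that i by auto
    ultimately show ?thesis by blast
  qed
  ultimately show ?thesis
    unfolding s_pattern_def by blast
qed

text \<open>No colour comes before the new one, so the old edges keep their witnesses even if \<open>x\<close> is one
  of them; the added edge has the witness \<open>z\<close>.\<close>

lemma s_pattern_prepend_pendant_edge:
  assumes pattern: "s_pattern s W M" and new: "z \<notin> W" "x \<noteq> z"
  shows "s_pattern (Suc s) (W \<union> {x, z}) (\<lambda>j. if j = 1 then {{x, z}} else M (j - 1))"
    (is "s_pattern _ _ ?M")
proof -
  have fresh: "z \<notin> e" if "j \<in> {1..s}" "e \<in> M j" for j e
    using s_pattern_edge_subset[OF pattern that] new by auto
  have range: "{1..Suc s} = insert 1 (Suc ` {1..s})"
    by auto
  \<comment> \<open>This rule would fold \<open>Suc ` {1..s}\<close> back into an interval and hide the shifted index.\<close>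
  note [simp del] = image_Suc_atLeastAtMost
  have un: "(\<Union>j\<in>{1..Suc s}. ?M j) = insert {x, z} (\<Union>j\<in>{1..s}. M j)"
    unfolding range by auto
  have "forest (W \<union> {x, z}) (\<Union>j\<in>{1..Suc s}. ?M j)"
    unfolding un using pattern new
    by (intro forest_insert_pendant_edge) (auto simp: s_pattern_def)
  moreover have "matching (?M j)" if "j \<in> {1..Suc s}" for j
  proof -
    have "matching {{x, z}}" by (simp add: matching_def)
    then show ?thesis
      using pattern that unfolding s_pattern_def range by auto
  qed
  moreover have "?M j \<inter> ?M k = {}" if "j \<in> {1..Suc s}" "k \<in> {1..Suc s}" "j \<noteq> k" for j k
  proof -
    have "{x, z} \<notin> M (l - 1)" if "l \<in> {1..Suc s}" "l \<noteq> 1" for l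
    proof -
      have "l - 1 \<in> {1..s}" using that by auto
      then show ?thesis using fresh by blast
    qed
    moreover have "M (j - 1) \<inter> M (k - 1) = {}" if "j \<noteq> 1" "k \<noteq> 1"
    proof -
      have "j - 1 \<in> {1..s}" "k - 1 \<in> {1..s}" "j - 1 \<noteq> k - 1"
        using that \<open>j \<in> {1..Suc s}\<close> \<open>k \<in> {1..Suc s}\<close> \<open>j \<noteq> k\<close> by auto
      then show ?thesis
        using pattern unfolding s_pattern_def by blast
    qed
    ultimately show ?thesis
      using that by auto
  qed
  moreover have "\<exists>u\<in>e. \<forall>k\<in>{j<..Suc s}. \<forall>f\<in>?M k. u \<notin> f"
    if j: "j \<in> {1..Suc s}" and e: "e \<in> ?M j" for j e
  proof (cases "j = 1")
    case True
    have "z \<notin> f" if "k \<in> {1<..Suc s}" "f \<in> ?M k" for k f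
    proof -
      have "k - 1 \<in> {1..s}" "f \<in> M (k - 1)" using that by auto
      then show ?thesis using fresh by blast
    qed
    then show ?thesis
      using True e by auto
  next
    case False
    then have "j - 1 \<in> {1..s}" "e \<in> M (j - 1)"
      using j e by auto
    then obtain u where u: "u \<in> e" "\<forall>k\<in>{j - 1<..s}. \<forall>f\<in>M k. u \<notin> f"
      using pattern unfolding s_pattern_def by blast
    have "u \<notin> f" if "k \<in> {j<..Suc s}" "f \<in> ?M k" for k f
    proof -
      have "k - 1 \<in> {j - 1<..s}" "f \<in> M (k - 1)"
        using that j by auto
      then show ?thesis using u(2) by blast
    qed
    then show ?thesis using u(1) by blast
  qed
  ultimately show ?thesis
    unfolding s_pattern_def by blast
qed

section \<open>Augmented patterns\<close>

text \<open>Equality replaces isomorphism so that a point outside \<open>V\<close> is new to both the pattern and the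
  augmenting points.\<close>

definition augments_to ::
    "nat \<Rightarrow> 'a set \<Rightarrow> (nat \<Rightarrow> 'a set set) \<Rightarrow> (nat \<Rightarrow> 'a) \<Rightarrow> 'a set \<Rightarrow> 'a set set \<Rightarrow> bool" where
  "augments_to s W M v V B \<longleftrightarrow>
     s_pattern s W M \<and> inj_on v {1..s} \<and> v ` {1..s} \<inter> W = {} \<and>
     V = augmented_points s W v \<and> B = augmented_blocks s M v"

lemma augments_to_insert_at_augmenting_point:
  assumes aug: "augments_to s W M v V B" and i: "i \<in> {1..s}"
    and new: "y \<notin> V" "z \<notin> V" "y \<noteq> z"
  shows "augments_to s (W \<union> {y, z}) (M(i := insert {y, z} (M i))) v
           (V \<union> {v i, y, z}) (insert {v i, y, z} B)"
    (is "augments_to _ _ ?M _ _ _")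
proof -
  have V: "V = W \<union> v ` {1..s}" and B: "B = augmented_blocks s M v"
    using aug unfolding augments_to_def augmented_points_def by auto
  have "s_pattern s (W \<union> {y, z}) (M(i := insert {y, z} (M i)))"
    using aug i new V by (intro s_pattern_insert_isolated_edge) (auto simp: augments_to_def)
  moreover have "v ` {1..s} \<inter> (W \<union> {y, z}) = {}"
    using aug new V unfolding augments_to_def by auto
  moreover have "V \<union> {v i, y, z} = augmented_points s (W \<union> {y, z}) v"
    using i unfolding V augmented_points_def by auto
  moreover have "insert {v i, y, z} B = augmented_blocks s ?M v"
  proof -
    have eq: "{y, z} \<union> {v i} = {v i, y, z}" by auto
    have "augmented_blocks s ?M v
        = (\<Union>j\<in>{1..s}. (if j = i then {{y, z} \<union> {v i}} else {}) \<union> (\<lambda>e. e \<union> {v j}) ` M j)"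
      unfolding augmented_blocks_def by (intro SUP_cong) auto
    also have "\<dots> = (\<Union>j\<in>{1..s}. if j = i then {{y, z} \<union> {v i}} else {}) \<union> B"
      unfolding B augmented_blocks_def by (rule UN_Un_distrib)
    also have "(\<Union>j\<in>{1..s}. if j = i then {{y, z} \<union> {v i}} else {}) = {{y, z} \<union> {v i}}"
      using i by (auto split: if_splits)
    finally show ?thesis unfolding eq by (simp only: insert_is_Un[symmetric])
  qed
  ultimately show ?thesis
    using aug unfolding augments_to_def by blast
qed

lemma augments_to_prepend:
  assumes aug: "augments_to s W M v V B" and x: "x \<notin> v ` {1..s}"
    and new: "y \<notin> V" "z \<notin> V" "y \<noteq> z" "x \<noteq> y" "x \<noteq> z"
  shows "augments_to (Suc s) (W \<union> {x, z}) (\<lambda>j. if j = 1 then {{x, z}} else M (j - 1))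
           (\<lambda>j. if j = 1 then y else v (j - 1)) (V \<union> {x, y, z}) (insert {x, y, z} B)"
    (is "augments_to _ _ ?M ?v _ _")
proof -
  have V: "V = W \<union> v ` {1..s}" and B: "B = augmented_blocks s M v"
    using aug unfolding augments_to_def augmented_points_def by auto
  have range: "{1..Suc s} = insert 1 (Suc ` {1..s})"
    by auto
  \<comment> \<open>This rule would fold \<open>Suc ` {1..s}\<close> back into an interval and hide the shifted index.\<close>
  note [simp del] = image_Suc_atLeastAtMost
  have shift: "(\<lambda>j. ?v (Suc j)) ` {1..s} = v ` {1..s}"
    by (intro image_cong) auto
  have im: "?v ` {1..Suc s} = insert y (v ` {1..s})"
    unfolding range image_insert image_image shift by simp
  have "s_pattern (Suc s) (W \<union> {x, z}) ?M"
    using aug new V by (intro s_pattern_prepend_pendant_edge) (auto simp: augments_to_def)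
  moreover have "inj_on ?v {1..Suc s}"
  proof (rule inj_onI)
    fix j k assume jk: "j \<in> {1..Suc s}" "k \<in> {1..Suc s}" "?v j = ?v k"
    have v: "inj_on v {1..s}"
      using aug unfolding augments_to_def by blast
    have y: "v (l - 1) \<noteq> y" if "l \<in> {1..Suc s}" "l \<noteq> 1" for l
    proof -
      have "l - 1 \<in> {1..s}" using that by auto
      then show ?thesis using new(1) unfolding V by blast
    qed
    show "j = k"
    proof (cases "j = 1 \<or> k = 1")
      case True
      then show ?thesis
        using jk y[of j] y[of k] by (auto split: if_splits)
    next
      case False
      then have "j - 1 \<in> {1..s}" "k - 1 \<in> {1..s}" "v (j - 1) = v (k - 1)"
        using jk by auto
      then have "j - 1 = k - 1"
        using v by (meson inj_onD)
      then show ?thesis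
        using False jk by auto
    qed
  qed
  moreover have "?v ` {1..Suc s} \<inter> (W \<union> {x, z}) = {}"
    using aug new x V unfolding augments_to_def im by auto
  moreover have "V \<union> {x, y, z} = augmented_points (Suc s) (W \<union> {x, z}) ?v"
    unfolding V augmented_points_def im by auto
  moreover have "insert {x, y, z} B = augmented_blocks (Suc s) ?M ?v"
  proof -
    have eq: "{x, z} \<union> {y} = {x, y, z}" by auto
    have "augmented_blocks (Suc s) ?M ?v
        = insert ({x, z} \<union> {y}) (\<Union>j\<in>{1..s}. (\<lambda>e. e \<union> {?v (Suc j)}) ` ?M (Suc j))"
      unfolding augmented_blocks_def range by simp
    also have "(\<Union>j\<in>{1..s}. (\<lambda>e. e \<union> {?v (Suc j)}) ` ?M (Suc j)) = B"
      unfolding B augmented_blocks_def by (intro SUP_cong) auto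
    finally show ?thesis unfolding eq by simp
  qed
  ultimately show ?thesis
    unfolding augments_to_def by blast
qed

lemma augments_to_empty:
  "augments_to 0 {} (\<lambda>_. {}) v {} {}"
  unfolding augments_to_def s_pattern_def forest_def simple_graph_def is_cycle_def
    augmented_points_def augmented_blocks_def
  by (auto intro!: exI[of _ 0])

lemma triple_with_two_new_points:
  assumes "card b = 3" and "card (b \<inter> V) \<le> 1"
  obtains x y z where "b = {x, y, z}" "x \<noteq> y" "x \<noteq> z" "y \<noteq> z" "y \<notin> V" "z \<notin> V"
proof -
  have fin: "finite b"
    using assms(1) by (simp add: card_ge_0_finite)
  have "card b = card (b \<inter> V) + card (b - V)"
    using fin by (metis card_Int_Diff)
  then have "2 \<le> card (b - V)"
    using assms by simp
  then obtain T where T: "T \<subseteq> b - V" "card T = 2"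
    by (meson obtain_subset_with_card_n)
  then obtain y z where yz: "T = {y, z}" "y \<noteq> z"
    by (auto simp: card_2_iff)
  have "card (b - T) = 1"
    using T assms(1) fin by (subst card_Diff_subset) (auto intro: finite_subset)
  then obtain x where "b - T = {x}"
    by (auto simp: card_1_singleton_iff)
  then show thesis
    using T yz by (intro that[of x y z]) auto
qed

lemma augments_to_add_block:
  assumes aug: "augments_to s W M v V B" and b: "card b = 3" "card (b \<inter> V) \<le> 1"
  shows "\<exists>s' W' M' v'. s' \<ge> 1 \<and> augments_to s' W' M' v' (V \<union> b) (insert b B)"
proof -
  obtain x y z where xyz: "b = {x, y, z}" "x \<noteq> y" "x \<noteq> z" "y \<noteq> z" "y \<notin> V" "z \<notin> V"
    using triple_with_two_new_points[OF b] .
  show ?thesis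
  proof (cases "x \<in> v ` {1..s}")
    case True
    then obtain i where i: "i \<in> {1..s}" "x = v i" by blast
    then have "s \<ge> 1" by simp
    then show ?thesis
      using augments_to_insert_at_augmenting_point[OF aug i(1) xyz(5,6,4)]
      unfolding xyz(1) i(2) by blast
  next
    case False
    have "Suc s \<ge> 1" by simp
    then show ?thesis
      using augments_to_prepend[OF aug False xyz(5,6,4,2,3)] unfolding xyz(1) by blast
  qed
qed

section \<open>Acyclic configurations\<close>

lemma acyclic_configuration_augments_to:
  assumes "acyclic_configuration V B"
  shows "\<exists>s W M v. s \<ge> 1 \<and> augments_to s W M v V B"
  using assms
proof (induction rule: acyclic_configuration.induct)
  case (single_block V B)
  obtain b where B: "B = {b}"
    using single_block.hyps(2) by (auto simp: card_1_singleton_iff)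
  have "V = b" "card b = 3"
    using single_block.hyps(1) unfolding B configuration_def triple_system_def by auto
  then show ?case
    using augments_to_add_block[OF augments_to_empty, of b] unfolding B by simp
next
  case (add_block V B b)
  then show ?case
    using augments_to_add_block by blast
qed

lemma configuration_imp_linear:
  assumes "configuration V B"
  shows "linear_triple_system V B"
proof -
  have ts: "triple_system V B"
    using assms unfolding configuration_def by blast
  have "card (b \<inter> b') \<le> 1" if "b \<in> B" "b' \<in> B" "b \<noteq> b'" for b b'
  proof -
    have sub: "b \<subseteq> V" and "finite V"
      using ts that unfolding triple_system_def by auto
    then have fin: "finite (b \<inter> b')"
      by (meson finite_Int finite_subset)
    have "x = y" if "x \<in> b \<inter> b'" "y \<in> b \<inter> b'" for x y
    proof (rule ccontr)
      assume "x \<noteq> y"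
      moreover have "x \<in> V" "y \<in> V" "{x, y} \<subseteq> b" "{x, y} \<subseteq> b'"
        using that sub by auto
      ultimately show False
        using assms \<open>b \<in> B\<close> \<open>b' \<in> B\<close> \<open>b \<noteq> b'\<close> unfolding configuration_def by meson
    qed
    then show ?thesis
      using card_le_Suc0_iff_eq[OF fin] by simp
  qed
  then show ?thesis
    using ts unfolding linear_triple_system_def by blast
qed

theorem proposition1p7:
  fixes V :: "'a set" and B :: "'a set set"
  assumes "acyclic_configuration V B"
  shows "\<exists>s::nat. s \<ge> 1 \<and> s_configuration s V B"
proof -
  obtain s W M v where s: "s \<ge> 1" and aug: "augments_to s W M v V B"
    using acyclic_configuration_augments_to[OF assms] by blast
  have V: "augmented_points s W v = V" and B: "augmented_blocks s M v = B"
    using aug unfolding augments_to_def by auto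
  have "linear_triple_system V B"
    using acyclic_configuration_imp_configuration[OF assms] by (rule configuration_imp_linear)
  moreover have "isomorphic_systems V B V B"
    unfolding isomorphic_systems_def by (intro exI[of _ id]) auto
  ultimately have "s_configuration s V B"
    using aug V B unfolding s_configuration_def augments_to_def by metis
  then show ?thesis using s by blast
qed

end
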